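(* Let $M_c=\sup\frac{|c(x,y_j)-c(x,y_k)|}{|y_j-y_k|}$, the supremum being over $x\in X$ and $j\ne k$, and assume $M_c<\infty$. Let $a=(a_j)_{j=1}^N$ with $a_j=M_c|y_j-y_1|$. Assume that $$\sup_{k\in\mathbb{R}}D^{\min}_\mu(y_i,k)-(f')^{-1}\left(J_{-a}(1)-M_c|y_{i+1}-y_1|\right)<0\quad\text{for all }1\le i\le N-2.$$ Then, letting $\nu$ be the minimizer of $$\min_{\nu\in\mathcal{P}(Y)}\left\{\mathcal{W}_c(\mu,\nu)+\mathcal{F}(\nu)\right\},\qquad \mathcal{F}(\nu)=\sum_{i=1}^N f(\nu_i),$$ the problem $(c,\mu,\nu)$ is discretely nested.
   Context: Let $X\subset\mathbb{R}^d$ be open and bounded, let $Y=\{y_1,\dots,y_N\}\subset\mathbb{R}$ be finite, and let $c\in C^2(X\times Y)$ satisfy $D_xc(x,y_{i+1})-D_xc(x,y_i)\neq 0$ for all $x\in X$ and $1\le i\le N-1$. Let $\mu\in\mathcal{P}(X)$ be a fixed probability measure. For $1\le i\le N-1$ and $k\in\mathbb{R}$ put $X^N_{=}(y_i,k)=\{x\in X: c(x,y_{i+1})-c(x,y_i)=k\}$, $X^N_{\ge}(y_i,k)=\{x\in X: c(x,y_{i+1})-c(x,y_i)\ge k\}$, and $X^N_{>}(y_i,k)=X^N_{\ge}(y_i,k)\setminus X^N_{=}(y_i,k)$. It is assumed throughout that $\mu(X^N_{=}(y_i,k))=0$ for all $i$ and $k$. For $\nu=\sum_{i=1}^N\nu_i\delta_{y_i}\in\mathcal{P}(Y)$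 and $1\le r\le N-1$, $k^N(y_r)$ is chosen such that $\mu(X^N_{\ge}(y_r,k^N(y_r)))=\sum_{i=1}^r\nu_i$. The optimal transport problem $(c,\mu,\nu)$ is called discretely nested if for all $1\le i\le N-2$ such that $\nu_{i+1}>0$ one has $X^N_{\ge}(y_i,k^N(y_i))\subset X^N_{>}(y_{i+1},k^N(y_{i+1}))$. For $1\le i\le N-2$ and a level $k_i$, the minimal mass difference is $D^{\min}_\mu(y_i,k_i)=\mu\left(X^N_{\ge}(y_{i+1},k_{\max}(y_i,k_i))\setminus X^N_{\ge}(y_i,k_i)\right)$, where $k_{\max}(y_i,k_i)=\sup\{k\in\mathbb{R}: X^N_{\ge}(y_i,k_i)\subseteq X^N_{\ge}(y_{i+1},k)\}$. $\mathcal{W}_c(\mu,\nu)=\min_{\gamma\in\Gamma(\mu,\nu)}\int_{X\times Y}c\,d\gamma$, where $\Gamma(\mu,\nu)$ is the set of probability measures on $X\times Y$ with marginals $\mu$ and $\nu$. The function $f:[0,\infty)\to\mathbb{R}$ is continuously differentiable on $(0,\infty)$, strictly convex, has superlinear growth, and satisfies $\lim_{s\to0^+}f'(s)=-\infty$ (these conditions guarantee existence and uniqueness of the minimizer). For a vector $v=(v_1,\dots,v_N)\in\mathbb{R}^N$, $J_v$ denotes the inverse of the strictly increasing function $s\mapsto\sum_{i=1}^N(f')^{-1}(s-v_i)$. *)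

theory Defs
  imports "HOL-Probability.Probability"
begin

text \<open>The finite set $Y$ is enumerated by \<open>y :: nat \<Rightarrow> real\<close> on \<open>{1..N}\<close>, so
  $Y$ is \<open>y ` {1..N}\<close>.  The cost is a function \<open>c :: 'a \<Rightarrow> real \<Rightarrow> real\<close>, of which only
  the values on $X \times Y$ matter.\<close>

definition C2_on :: "'a::real_normed_vector set \<Rightarrow> ('a \<Rightarrow> real) \<Rightarrow> bool" where
  "C2_on X g \<longleftrightarrow>
    (\<exists>(g' :: 'a \<Rightarrow> 'a \<Rightarrow>\<^sub>L real) (g'' :: 'a \<Rightarrow> 'a \<Rightarrow>\<^sub>L 'a \<Rightarrow>\<^sub>L real).
       (\<forall>x\<in>X. (g has_derivative blinfun_apply (g' x)) (at x)) \<and>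
       (\<forall>x\<in>X. (g' has_derivative blinfun_apply (g'' x)) (at x)) \<and>
       continuous_on X g'')"

definition strictly_convex_on :: "real set \<Rightarrow> (real \<Rightarrow> real) \<Rightarrow> bool" where
  "strictly_convex_on S f \<longleftrightarrow>
    convex S \<and>
    (\<forall>s\<in>S. \<forall>t\<in>S. \<forall>u. s \<noteq> t \<and> 0 < u \<and> u < 1 \<longrightarrow>
       f ((1 - u) * s + u * t) < (1 - u) * f s + u * f t)"

definition prob_measures_on :: "'a::topological_space set \<Rightarrow> 'a measure set" where
  "prob_measures_on S = {M. prob_space M \<and> sets M = sets (restrict_space borel S)}"

definition couplings :: "'a measure \<Rightarrow> 'b measure \<Rightarrow> ('a \<times> 'b) measure set" where
  "couplings \<mu> \<nu> = {\<gamma>. prob_space \<gamma> \<and> sets \<gamma> = sets (\<mu> \<Otimes>\<^sub>M \<nu>) \<and>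
                      distr \<gamma> \<mu> fst = \<mu> \<and> distr \<gamma> \<nu> snd = \<nu>}"

definition transport_cost :: "('a \<Rightarrow> 'b \<Rightarrow> real) \<Rightarrow> 'a measure \<Rightarrow> 'b measure \<Rightarrow> real" where
  "transport_cost c \<mu> \<nu> = (INF \<gamma>\<in>couplings \<mu> \<nu>. \<integral>p. c (fst p) (snd p) \<partial>\<gamma>)"

definition energy :: "(real \<Rightarrow> real) \<Rightarrow> (nat \<Rightarrow> real) \<Rightarrow> nat \<Rightarrow> real measure \<Rightarrow> real" where
  "energy f y N \<nu> = (\<Sum>i=1..N. f (measure \<nu> {y i}))"

definition X_eq :: "'a set \<Rightarrow> ('a \<Rightarrow> real \<Rightarrow> real) \<Rightarrow> (nat \<Rightarrow> real) \<Rightarrow> nat \<Rightarrow> real \<Rightarrow> 'a set" where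
  "X_eq X c y i k = {x \<in> X. c x (y (i + 1)) - c x (y i) = k}"

text \<open>The level is extended real because $k_{\max}$ below is \<open>\<infinity>\<close> when the superlevel set of
  index \<open>i\<close> is empty; then \<open>X_ge X c y (i + 1) \<infinity>\<close> is empty as well.\<close>

definition X_ge :: "'a set \<Rightarrow> ('a \<Rightarrow> real \<Rightarrow> real) \<Rightarrow> (nat \<Rightarrow> real) \<Rightarrow> nat \<Rightarrow> ereal \<Rightarrow> 'a set" where
  "X_ge X c y i k = {x \<in> X. ereal (c x (y (i + 1)) - c x (y i)) \<ge> k}"

definition X_gt :: "'a set \<Rightarrow> ('a \<Rightarrow> real \<Rightarrow> real) \<Rightarrow> (nat \<Rightarrow> real) \<Rightarrow> nat \<Rightarrow> real \<Rightarrow> 'a set" where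
  "X_gt X c y i k = X_ge X c y i (ereal k) - X_eq X c y i k"

definition k_max ::
  "'a set \<Rightarrow> ('a \<Rightarrow> real \<Rightarrow> real) \<Rightarrow> (nat \<Rightarrow> real) \<Rightarrow> nat \<Rightarrow> real \<Rightarrow> ereal" where
  "k_max X c y i k =
    Sup {ereal l | l. X_ge X c y i (ereal k) \<subseteq> X_ge X c y (i + 1) (ereal l)}"

definition D_min ::
  "'a set \<Rightarrow> ('a \<Rightarrow> real \<Rightarrow> real) \<Rightarrow> (nat \<Rightarrow> real) \<Rightarrow> 'a measure \<Rightarrow> nat \<Rightarrow> real \<Rightarrow> real" where
  "D_min X c y \<mu> i k =
    measure \<mu> (X_ge X c y (i + 1) (k_max X c y i k) - X_ge X c y i (ereal k))"

definition splitting_levels ::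
  "'a set \<Rightarrow> ('a \<Rightarrow> real \<Rightarrow> real) \<Rightarrow> (nat \<Rightarrow> real) \<Rightarrow> nat \<Rightarrow> 'a measure \<Rightarrow> real measure
    \<Rightarrow> (nat \<Rightarrow> real) \<Rightarrow> bool" where
  "splitting_levels X c y N \<mu> \<nu> k \<longleftrightarrow>
    (\<forall>r\<in>{1..N-1}. measure \<mu> (X_ge X c y r (ereal (k r))) = (\<Sum>i=1..r. measure \<nu> {y i}))"

text \<open>The levels $k^N(y_r)$ need not be unique; nestedness is required for every admissible
  choice, and at least one choice has to exist.\<close>

definition discretely_nested ::
  "'a set \<Rightarrow> ('a \<Rightarrow> real \<Rightarrow> real) \<Rightarrow> (nat \<Rightarrow> real) \<Rightarrow> nat \<Rightarrow> 'a measure \<Rightarrow> real measure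
    \<Rightarrow> bool" where
  "discretely_nested X c y N \<mu> \<nu> \<longleftrightarrow>
    (\<exists>k. splitting_levels X c y N \<mu> \<nu> k) \<and>
    (\<forall>k. splitting_levels X c y N \<mu> \<nu> k \<longrightarrow>
       (\<forall>i\<in>{1..N-2}. measure \<nu> {y (i + 1)} > 0 \<longrightarrow>
          X_ge X c y i (ereal (k i)) \<subseteq> X_gt X c y (i + 1) (k (i + 1))))"

text \<open>The supremum of this set is $M_c$.\<close>

definition cost_slopes ::
  "'a set \<Rightarrow> ('a \<Rightarrow> real \<Rightarrow> real) \<Rightarrow> (nat \<Rightarrow> real) \<Rightarrow> nat \<Rightarrow> real set" where
  "cost_slopes X c y N =
    {\<bar>c x (y j) - c x (y k)\<bar> / \<bar>y j - y k\<bar> | x j k.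
       x \<in> X \<and> j \<in> {1..N} \<and> k \<in> {1..N} \<and> j \<noteq> k}"

definition deriv_inv :: "(real \<Rightarrow> real) \<Rightarrow> real \<Rightarrow> real" where
  "deriv_inv f = the_inv_into {0<..} (deriv f)"

definition J :: "(real \<Rightarrow> real) \<Rightarrow> nat \<Rightarrow> (nat \<Rightarrow> real) \<Rightarrow> real \<Rightarrow> real" where
  "J f N v = the_inv_into UNIV (\<lambda>s. \<Sum>i=1..N. deriv_inv f (s - v i))"

end

theory Submission
  imports Defs
begin

text \<open>
  The minimiser has to give every point \<open>y\<^sub>i\<close> a mass \<open>\<nu>\<^sub>i\<close> that is not too small; nestedness then
  follows by comparing masses of superlevel sets.

  The lower bound on the masses comes from a perturbation that does not use dual potentials. Given
  a coupling of \<open>\<mu>\<close> and \<open>\<nu>\<close>, a biased independent coin sends a fraction of the mass above \<open>y\<^sub>j\<close>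
  to \<open>y\<^sub>i\<close> instead. If \<open>\<epsilon>\<close> units of mass are moved in this way, the transport cost increases by at
  most \<open>\<epsilon> M \<bar>y\<^sub>i - y\<^sub>j\<bar>\<close> (\<open>transport_cost_shift_mass_le\<close>). Since the energy cannot decrease by
  more than that, every \<open>\<nu>\<^sub>i\<close> is positive, because \<open>f'\<close> tends to \<open>-\<infinity>\<close> at 0, and
  \<open>f'(\<nu>\<^sub>j) \<le> f'(\<nu>\<^sub>i) + M \<bar>y\<^sub>i - y\<^sub>j\<bar>\<close> for all \<open>i\<close> and \<open>j\<close> (\<open>no_profitable_transfer\<close>). Comparing all
  indices with 1 and using that the masses add up to 1 gives \<open>f'(\<nu>\<^sub>1) \<ge> J\<^sub>-\<^sub>a(1)\<close> and hence
  \<open>\<nu>\<^sub>i \<ge> (f')\<^sup>-\<^sup>1 (J\<^sub>-\<^sub>a(1) - a\<^sub>i)\<close> (\<open>mass_lower_bound\<close>). No integrability of the cost is needed: a cost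
  that is not integrable for a coupling stays so after the perturbation, as the two costs differ by
  a bounded function.

  By hypothesis \<open>\<nu>\<close> therefore charges \<open>y\<^bsub>i+1\<^esub>\<close> with more than the minimal mass difference at any
  level \<open>k\<close> of index \<open>i\<close>. The superlevel set of index \<open>i+1\<close> at its splitting level then has more mass
  than the one at level \<open>k_max\<close>, so that its level is strictly smaller than \<open>k_max\<close>, which yields the
  strict inclusion (\<open>X_ge_subset_X_gt\<close>).
\<close>

section \<open>The derivative of a strictly convex energy density\<close>

lemma C1_deriv:
  fixes f :: "real \<Rightarrow> real"
  assumes "f C1_differentiable_on S"
  shows C1_has_deriv: "s \<in> S \<Longrightarrow> (f has_real_derivative deriv f s) (at s)"
    and C1_continuous_deriv: "continuous_on S (deriv f)"
proof -
  obtain D where D: "\<And>x. x \<in> S \<Longrightarrow> (f has_real_derivative D x) (at x)" "continuous_on S D"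
    using assms unfolding C1_differentiable_on_def has_real_derivative_iff_has_vector_derivative
    by blast
  have eq: "deriv f x = D x" if "x \<in> S" for x
    using D(1)[OF that] by (rule DERIV_imp_deriv)
  show "s \<in> S \<Longrightarrow> (f has_real_derivative deriv f s) (at s)"
    using D(1) eq by simp
  show "continuous_on S (deriv f)"
    using D(2) eq by (simp cong: continuous_on_cong)
qed

lemma strictly_convex_on_imp_convex_on:
  assumes "strictly_convex_on S f"
  shows "convex_on S f"
proof (rule convex_onI)
  show "convex S"
    using assms by (simp add: strictly_convex_on_def)
next
  fix t x y :: real
  assume *: "0 < t" "t < 1" "x \<in> S" "y \<in> S"
  show "f ((1 - t) *\<^sub>R x + t *\<^sub>R y) \<le> (1 - t) * f x + t * f y"
  proof (cases "x = y")
    case True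
    then show ?thesis by (simp add: algebra_simps)
  next
    case False
    then have "f ((1 - t) * x + t * y) < (1 - t) * f x + t * f y"
      using * assms unfolding strictly_convex_on_def by blast
    then show ?thesis by simp
  qed
qed

lemma strictly_convex_above_tangent:
  assumes C1: "f C1_differentiable_on {0<..}" and sc: "strictly_convex_on {0..} f"
    and "s > 0" "t \<ge> 0" "t \<noteq> s"
  shows "f t > f s + deriv f s * (t - s)"
proof -
  define m where "m = (s + t) / 2"
  have "f m - f s \<ge> deriv f s * (m - s)"
  proof (rule convex_on_imp_above_tangent)
    show "convex_on {0..} f" by (rule strictly_convex_on_imp_convex_on[OF sc])
    show "(f has_real_derivative deriv f s) (at s within {0..})"
      using C1_has_deriv[OF C1, of s] \<open>s > 0\<close> has_field_derivative_at_within by auto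
  qed (use assms in \<open>auto simp: m_def\<close>)
  moreover have "f ((1 - 1/2) * s + 1/2 * t) < (1 - 1/2) * f s + 1/2 * f t"
    using sc assms unfolding strictly_convex_on_def
    by (metis atLeast_iff half_gt_zero_iff less_eq_real_def zero_less_one field_sum_of_halves
        less_add_same_cancel2)
  moreover have "(1 - 1/2) * s + 1/2 * t = m" "m - s = (t - s) / 2"
    by (simp_all add: m_def field_simps)
  ultimately show ?thesis
    by simp
qed

lemma deriv_strict_mono:
  assumes C1: "f C1_differentiable_on {0<..}" and sc: "strictly_convex_on {0..} f"
    and st: "0 < s" "s < t"
  shows "deriv f s < deriv f t"
proof -
  have "f t > f s + deriv f s * (t - s)" "f s > f t + deriv f t * (s - t)"
    using strictly_convex_above_tangent[OF C1 sc] st by simp_all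
  then have "deriv f s * (t - s) < deriv f t * (t - s)"
    by (simp add: algebra_simps)
  then show ?thesis
    using st by simp
qed

lemma deriv_mono_iff:
  assumes C1: "f C1_differentiable_on {0<..}" and sc: "strictly_convex_on {0..} f"
    and "0 < s" "0 < t"
  shows "deriv f s \<le> deriv f t \<longleftrightarrow> s \<le> t"
  using deriv_strict_mono[OF C1 sc] assms(3,4) by (metis linorder_not_le order_le_less)

text \<open>The blow-up of \<open>f'\<close> at 0 provides values below \<open>p\<close>; superlinear growth provides values
  above, for a derivative bounded by \<open>p\<close> would make \<open>f\<close> grow at most linearly.\<close>

lemma deriv_surj:
  assumes C1: "f C1_differentiable_on {0<..}" and sc: "strictly_convex_on {0..} f"
    and superlin: "filterlim (\<lambda>s. f s / s) at_top at_top"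
    and deriv0: "filterlim (deriv f) at_bot (at_right 0)"
  shows "\<exists>s>0. deriv f s = p"
proof -
  have "\<forall>\<^sub>F s in at_right 0. deriv f s \<le> p"
    using deriv0 by (auto simp: filterlim_at_bot)
  then obtain l where l: "l > 0" "\<And>s. 0 < s \<Longrightarrow> s < l \<Longrightarrow> deriv f s \<le> p"
    unfolding eventually_at_right_field by auto
  define s where "s = min (l / 2) 1"
  have s: "0 < s" "s \<le> 1" "deriv f s \<le> p"
    using l by (auto simp: s_def)
  have "\<forall>\<^sub>F t in at_top. \<bar>f 1\<bar> + \<bar>p\<bar> < f t / t"
    using superlin by (simp add: filterlim_at_top_dense)
  then have "\<forall>\<^sub>F t in at_top. t > 1 \<and> \<bar>f 1\<bar> + \<bar>p\<bar> < f t / t"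
    using eventually_gt_at_top[of 1] by eventually_elim auto
  then obtain t where t: "t > 1" "\<bar>f 1\<bar> + \<bar>p\<bar> < f t / t"
    using eventually_happens'[OF trivial_limit_at_top_linorder] by blast
  have "p \<le> deriv f t"
  proof (rule ccontr)
    assume "\<not> p \<le> deriv f t"
    then have "deriv f t * (t - 1) \<le> \<bar>p\<bar> * (t - 1)"
      using t by (intro mult_right_mono) auto
    moreover have "f 1 > f t + deriv f t * (1 - t)"
      using strictly_convex_above_tangent[OF C1 sc, of t 1] t by simp
    moreover have "\<bar>f 1\<bar> \<le> \<bar>f 1\<bar> * t"
      using t by (simp add: mult_le_cancel_left1)
    ultimately have "f t \<le> (\<bar>f 1\<bar> + \<bar>p\<bar>) * t"
      by (simp add: algebra_simps)
    then show False
      using t by (simp add: field_simps)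
  qed
  moreover have "continuous_on {s..t} (deriv f)"
    using C1_continuous_deriv[OF C1] s by (rule_tac continuous_on_subset) auto
  ultimately obtain r where "s \<le> r" "r \<le> t" "deriv f r = p"
    using IVT'[of "deriv f" s p t] s t by auto
  with s show ?thesis by (intro exI[of _ r]) auto
qed

lemma deriv_inv:
  assumes C1: "f C1_differentiable_on {0<..}" and sc: "strictly_convex_on {0..} f"
    and superlin: "filterlim (\<lambda>s. f s / s) at_top at_top"
    and deriv0: "filterlim (deriv f) at_bot (at_right 0)"
  shows deriv_inv_pos: "deriv_inv f p > 0"
    and deriv_deriv_inv: "deriv f (deriv_inv f p) = p"
    and deriv_inv_deriv: "s > 0 \<Longrightarrow> deriv_inv f (deriv f s) = s"
proof -
  have inj: "inj_on (deriv f) {0<..}"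
    by (rule strict_mono_on_imp_inj_on, rule strict_mono_onI)
      (use deriv_strict_mono[OF C1 sc] in auto)
  have img: "p \<in> deriv f ` {0<..}"
    using deriv_surj[OF assms, of p] by auto
  show "deriv_inv f p > 0"
    using the_inv_into_into[OF inj img] by (auto simp: deriv_inv_def)
  show "deriv f (deriv_inv f p) = p"
    unfolding deriv_inv_def by (rule f_the_inv_into_f[OF inj img])
  show "deriv_inv f (deriv f s) = s" if "s > 0"
    unfolding deriv_inv_def using that by (intro the_inv_into_f_f[OF inj]) auto
qed

lemma deriv_inv_le_iff:
  assumes C1: "f C1_differentiable_on {0<..}" and sc: "strictly_convex_on {0..} f"
    and superlin: "filterlim (\<lambda>s. f s / s) at_top at_top"
    and deriv0: "filterlim (deriv f) at_bot (at_right 0)"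
  shows "deriv_inv f p \<le> deriv_inv f q \<longleftrightarrow> p \<le> q"
  using deriv_mono_iff[OF C1 sc deriv_inv_pos[OF assms, of p] deriv_inv_pos[OF assms, of q]]
  by (simp add: deriv_deriv_inv[OF assms])

lemma continuous_deriv_inv:
  assumes C1: "f C1_differentiable_on {0<..}" and sc: "strictly_convex_on {0..} f"
    and superlin: "filterlim (\<lambda>s. f s / s) at_top at_top"
    and deriv0: "filterlim (deriv f) at_bot (at_right 0)"
  shows "continuous_on UNIV (deriv_inv f)"
proof (rule continuous_onI_mono)
  have "range (deriv_inv f) = {0<..}"
    using deriv_inv_pos[OF assms] deriv_inv_deriv[OF assms] by (auto simp: image_iff) metis
  then show "open (range (deriv_inv f))"
    by simp
qed (simp add: deriv_inv_le_iff[OF assms])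

text \<open>The defining equation of \<open>J\<close> at the value 1. Among the arguments of the sum,
  \<open>f'(1/N) + min\<^sub>i v\<^sub>i\<close> makes every term at most \<open>1/N\<close> and \<open>f'(1) + v\<^sub>1\<close> makes the first term 1,
  so the value 1 is taken in between.\<close>

lemma sum_deriv_inv_J:
  assumes C1: "f C1_differentiable_on {0<..}" and sc: "strictly_convex_on {0..} f"
    and superlin: "filterlim (\<lambda>s. f s / s) at_top at_top"
    and deriv0: "filterlim (deriv f) at_bot (at_right 0)"
    and N: "N \<ge> 1"
  shows "(\<Sum>i=1..N. deriv_inv f (J f N v 1 - v i)) = 1"
proof -
  note dinv = C1 sc superlin deriv0
  define h where "h = (\<lambda>s. \<Sum>i=1..N. deriv_inv f (s - v i))"
  have mono: "strict_mono h"
  proof (rule strict_monoI)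
    fix s t :: real
    assume "s < t"
    then show "h s < h t"
      unfolding h_def using N deriv_inv_le_iff[OF dinv]
      by (intro sum_strict_mono) (auto simp: not_le[symmetric])
  qed
  have cont: "continuous_on UNIV h"
    unfolding h_def
    by (intro continuous_on_sum continuous_on_compose2[OF continuous_deriv_inv[OF dinv]]
        continuous_intros) auto
  define lo where "lo = deriv f (1 / N) + Min (v ` {1..N})"
  define hi where "hi = deriv f 1 + v 1"
  have "h lo \<le> (\<Sum>i=1..N. 1 / real N)"
    unfolding h_def
  proof (rule sum_mono)
    fix i assume i: "i \<in> {1..N}"
    then have "lo - v i \<le> deriv f (1 / N)"
      by (simp add: lo_def)
    then have "deriv_inv f (lo - v i) \<le> deriv_inv f (deriv f (1 / N))"
      by (simp add: deriv_inv_le_iff[OF dinv])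
    also have "\<dots> = 1 / N"
      using N by (intro deriv_inv_deriv[OF dinv]) auto
    finally show "deriv_inv f (lo - v i) \<le> 1 / N" .
  qed
  also have "\<dots> = 1"
    using N by simp
  finally have lo: "h lo \<le> 1" .
  have "1 = deriv_inv f (hi - v 1)"
    using deriv_inv_deriv[OF dinv, of 1] by (simp add: hi_def)
  also have "\<dots> \<le> h hi"
    unfolding h_def using N deriv_inv_pos[OF dinv]
    by (intro member_le_sum) (auto intro: less_imp_le)
  finally have hi: "1 \<le> h hi" .
  have "lo \<le> hi"
    using lo hi strict_mono_less[OF mono, of hi lo] strict_mono_less_eq[OF mono, of lo hi]
    by linarith
  then obtain s where "h s = 1"
    using IVT'[of h lo 1 hi] lo hi continuous_on_subset[OF cont] by auto
  then have "h (the_inv_into UNIV h 1) = 1"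
    using strict_mono_imp_inj_on[OF mono] by (intro f_the_inv_into_f) (auto simp: image_iff)
  then show ?thesis
    unfolding J_def h_def .
qed

section \<open>Moving mass between two points of the target\<close>

text \<open>The random map that moves the point \<open>u\<close> to \<open>v\<close> when the coin shows \<open>True\<close> and fixes
  everything else.\<close>

definition move :: "'b \<Rightarrow> 'b \<Rightarrow> 'b \<times> bool \<Rightarrow> 'b" where
  "move u v q = (if snd q \<and> fst q = u then v else fst q)"

text \<open>The measure obtained from \<open>\<nu>\<close> by moving the fraction \<open>t\<close> of the mass at \<open>u\<close> to \<open>v\<close>, for
  \<open>t\<close> between 0 and 1.\<close>

definition shift_mass :: "real \<Rightarrow> 'b \<Rightarrow> 'b \<Rightarrow> 'b measure \<Rightarrow> 'b measure" where
  "shift_mass t u v \<nu> = distr (\<nu> \<Otimes>\<^sub>M measure_pmf (bernoulli_pmf t)) \<nu> (move u v)"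

lemma measurable_move:
  assumes "sets \<nu> = Pow (space \<nu>)" "v \<in> space \<nu>"
  shows "move u v \<in> measurable (\<nu> \<Otimes>\<^sub>M measure_pmf p) \<nu>"
proof -
  have [measurable]: "(\<lambda>z. z = u) \<in> measurable \<nu> (count_space UNIV)"
    using assms(1) by (intro measurable_count_space_eq2[THEN iffD2] pred_def[THEN iffD2]) auto
  show ?thesis
    unfolding move_def using assms(2) by measurable
qed

lemma
  assumes "prob_space \<nu>" "sets \<nu> = Pow (space \<nu>)" "v \<in> space \<nu>"
  shows prob_space_shift_mass: "prob_space (shift_mass t u v \<nu>)"
    and sets_shift_mass: "sets (shift_mass t u v \<nu>) = sets \<nu>"
proof -
  interpret \<nu>: prob_space \<nu> by fact
  interpret P: pair_prob_space \<nu> "measure_pmf (bernoulli_pmf t)" ..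
  show "prob_space (shift_mass t u v \<nu>)"
    unfolding shift_mass_def by (rule P.prob_space_distr[OF measurable_move[OF assms(2,3)]])
qed (simp add: shift_mass_def)

lemma measure_pair_pmf_Times:
  assumes "A \<in> sets M"
  shows "measure (M \<Otimes>\<^sub>M measure_pmf p) (A \<times> C) = measure M A * measure (measure_pmf p) C"
  using measure_pmf.emeasure_pair_measure_Times[OF assms, of C p]
  by (simp add: measure_def enn2real_mult)

lemma measure_shift_mass:
  assumes "prob_space \<nu>" "sets \<nu> = Pow (space \<nu>)" "u \<in> space \<nu>" "v \<in> space \<nu>" "u \<noteq> v"
    and t: "0 \<le> t" "t \<le> 1" and z: "z \<in> space \<nu>"
  shows "measure (shift_mass t u v \<nu>) {z} =
    (if z = u then (1 - t) * measure \<nu> {u} else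
     if z = v then measure \<nu> {v} + t * measure \<nu> {u} else measure \<nu> {z})"
proof -
  let ?B = "measure_pmf (bernoulli_pmf t)"
  interpret \<nu>: prob_space \<nu> by fact
  interpret P: pair_prob_space \<nu> ?B ..
  have single: "{x} \<in> sets \<nu>" if "x \<in> space \<nu>" for x
    using assms(2) that by auto
  have Times: "measure (\<nu> \<Otimes>\<^sub>M ?B) ({x} \<times> C) = measure \<nu> {x} * measure ?B C"
    if "x \<in> space \<nu>" for x C
    by (rule measure_pair_pmf_Times[OF single[OF that]])
  have B: "measure ?B {True} = t" "measure ?B {False} = 1 - t"
    using t by (simp_all add: measure_pmf_single)
  have eq: "measure (shift_mass t u v \<nu>) {z} =
      measure (\<nu> \<Otimes>\<^sub>M ?B) (move u v -` {z} \<inter> space (\<nu> \<Otimes>\<^sub>M ?B))"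
    unfolding shift_mass_def
    by (rule measure_distr[OF measurable_move[OF assms(2,4)] single[OF z]])
  consider "z = u" | "z = v" | "z \<noteq> u" "z \<noteq> v" by blast
  then show ?thesis
  proof cases
    case 1
    have "move u v -` {z} \<inter> space (\<nu> \<Otimes>\<^sub>M ?B) = {u} \<times> {False}"
      using 1 assms by (auto simp: move_def space_pair_measure split: if_splits)
    then show ?thesis
      using eq 1 Times[OF assms(3), of "{False}"] B by simp
  next
    case 2
    have "move u v -` {z} \<inter> space (\<nu> \<Otimes>\<^sub>M ?B) = {v} \<times> UNIV \<union> {u} \<times> {True}"
      using 2 assms by (auto simp: move_def space_pair_measure split: if_splits)
    moreover have "measure (\<nu> \<Otimes>\<^sub>M ?B) ({v} \<times> UNIV \<union> {u} \<times> {True}) =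
        measure (\<nu> \<Otimes>\<^sub>M ?B) ({v} \<times> UNIV) + measure (\<nu> \<Otimes>\<^sub>M ?B) ({u} \<times> {True})"
      using pair_measureI[OF single[OF assms(4)], of UNIV ?B]
        pair_measureI[OF single[OF assms(3)], of "{True}" ?B] assms(5)
      by (intro P.finite_measure_Union) auto
    ultimately show ?thesis
      using eq 2 Times[OF assms(4), of UNIV] Times[OF assms(3), of "{True}"] assms(5) B
        measure_pmf.prob_space[of "bernoulli_pmf t"] by simp
  next
    case 3
    have "move u v -` {z} \<inter> space (\<nu> \<Otimes>\<^sub>M ?B) = {z} \<times> UNIV"
      using 3 z by (auto simp: move_def space_pair_measure split: if_splits)
    then show ?thesis
      using eq 3 Times[OF z] measure_pmf.prob_space[of "bernoulli_pmf t"] by simp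
  qed
qed

text \<open>The same random map acts on couplings, through the second coordinate.\<close>

definition shift_coupling ::
  "real \<Rightarrow> 'b \<Rightarrow> 'b \<Rightarrow> 'a measure \<Rightarrow> 'b measure \<Rightarrow> ('a \<times> 'b) measure \<Rightarrow> ('a \<times> 'b) measure" where
  "shift_coupling t u v \<mu> \<nu> \<gamma> = distr (\<gamma> \<Otimes>\<^sub>M measure_pmf (bernoulli_pmf t)) (\<mu> \<Otimes>\<^sub>M \<nu>)
     (\<lambda>q. (fst (fst q), move u v (snd (fst q), snd q)))"

lemma couplings_marginals:
  assumes "\<gamma> \<in> couplings \<mu> \<nu>"
  shows coupling_fst: "fst \<in> measurable \<gamma> \<mu>" and coupling_snd: "snd \<in> measurable \<gamma> \<nu>"
    and "space \<gamma> = space \<mu> \<times> space \<nu>"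
proof -
  have s: "sets \<gamma> = sets (\<mu> \<Otimes>\<^sub>M \<nu>)"
    using assms by (simp add: couplings_def)
  show "fst \<in> measurable \<gamma> \<mu>" "snd \<in> measurable \<gamma> \<nu>"
    by (simp_all cong: measurable_cong_sets add: measurable_cong_sets[OF s])
  show "space \<gamma> = space \<mu> \<times> space \<nu>"
    using sets_eq_imp_space_eq[OF s] by (simp add: space_pair_measure)
qed

lemma measurable_shift_coupling:
  assumes \<gamma>: "\<gamma> \<in> couplings \<mu> \<nu>" and \<nu>: "sets \<nu> = Pow (space \<nu>)" "v \<in> space \<nu>"
  shows "(\<lambda>q. (fst (fst q), move u v (snd (fst q), snd q)))
    \<in> measurable (\<gamma> \<Otimes>\<^sub>M measure_pmf p) (\<mu> \<Otimes>\<^sub>M \<nu>)"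
proof -
  note [measurable] = coupling_fst[OF \<gamma>] coupling_snd[OF \<gamma>] measurable_move[OF \<nu>]
  show ?thesis by measurable
qed

lemma shift_coupling_in_couplings:
  assumes \<gamma>: "\<gamma> \<in> couplings \<mu> \<nu>" and \<nu>: "sets \<nu> = Pow (space \<nu>)" "v \<in> space \<nu>"
  shows "shift_coupling t u v \<mu> \<nu> \<gamma> \<in> couplings \<mu> (shift_mass t u v \<nu>)"
proof -
  let ?B = "measure_pmf (bernoulli_pmf t)"
  let ?h = "\<lambda>q. (fst (fst q), move u v (snd (fst q), snd q))"
  have d: "distr \<gamma> \<mu> fst = \<mu>" "distr \<gamma> \<nu> snd = \<nu>"
    using \<gamma> by (auto simp: couplings_def)
  interpret \<gamma>: prob_space \<gamma> using \<gamma> by (simp add: couplings_def)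
  interpret P: pair_prob_space \<gamma> ?B ..
  note m = measurable_shift_coupling[OF \<gamma> \<nu>, of u "bernoulli_pmf t"]
  note [measurable] = coupling_fst[OF \<gamma>] coupling_snd[OF \<gamma>] measurable_move[OF \<nu>]
  have "prob_space (shift_coupling t u v \<mu> \<nu> \<gamma>)"
    unfolding shift_coupling_def by (rule P.prob_space_distr[OF m])
  moreover have "sets (shift_coupling t u v \<mu> \<nu> \<gamma>) = sets (\<mu> \<Otimes>\<^sub>M shift_mass t u v \<nu>)"
    by (simp add: shift_coupling_def shift_mass_def cong: sets_pair_measure_cong)
  moreover have "distr (shift_coupling t u v \<mu> \<nu> \<gamma>) \<mu> fst = \<mu>"
  proof -
    have "distr (shift_coupling t u v \<mu> \<nu> \<gamma>) \<mu> fst = distr (\<gamma> \<Otimes>\<^sub>M ?B) \<mu> (fst \<circ> ?h)"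
      unfolding shift_coupling_def by (rule distr_distr[OF measurable_fst m])
    also have "\<dots> = distr (\<gamma> \<Otimes>\<^sub>M ?B) \<mu> (fst \<circ> fst)"
      by (simp add: comp_def)
    also have "\<dots> = distr (distr (\<gamma> \<Otimes>\<^sub>M ?B) \<gamma> fst) \<mu> fst"
      by (rule distr_distr[symmetric]) measurable
    also have "\<dots> = \<mu>"
      using d by (simp add: measure_pmf.distr_pair_fst)
    finally show ?thesis .
  qed
  moreover have "distr (shift_coupling t u v \<mu> \<nu> \<gamma>) (shift_mass t u v \<nu>) snd = shift_mass t u v \<nu>"
  proof -
    have "distr (shift_coupling t u v \<mu> \<nu> \<gamma>) (shift_mass t u v \<nu>) snd =
        distr (shift_coupling t u v \<mu> \<nu> \<gamma>) \<nu> snd"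
      by (rule distr_cong) (simp_all add: shift_mass_def)
    also have "\<dots> = distr (\<gamma> \<Otimes>\<^sub>M ?B) \<nu> (snd \<circ> ?h)"
      unfolding shift_coupling_def by (rule distr_distr[OF measurable_snd m])
    also have "\<dots> = distr (\<gamma> \<Otimes>\<^sub>M ?B) \<nu> (move u v \<circ> (\<lambda>(p, b). (snd p, b)))"
      by (simp add: comp_def case_prod_beta)
    also have "\<dots> = distr (distr (\<gamma> \<Otimes>\<^sub>M ?B) (\<nu> \<Otimes>\<^sub>M ?B) (\<lambda>(p, b). (snd p, b))) \<nu> (move u v)"
      by (rule distr_distr[symmetric]) measurable
    also have "distr (\<gamma> \<Otimes>\<^sub>M ?B) (\<nu> \<Otimes>\<^sub>M ?B) (\<lambda>(p, b). (snd p, b)) = distr \<gamma> \<nu> snd \<Otimes>\<^sub>M distr ?B ?B (\<lambda>b. b)"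
      by (rule pair_measure_distr[symmetric])
        (auto simp: distr_id intro: measure_pmf.sigma_finite_measure_axioms)
    finally show ?thesis
      by (simp add: shift_mass_def d distr_id)
  qed
  ultimately show ?thesis
    by (simp add: couplings_def)
qed

text \<open>When the cost is not integrable, both integrals take the default value 0 and the estimate
  still holds.\<close>

lemma integral_shift_coupling_le:
  fixes c :: "'a \<Rightarrow> 'b \<Rightarrow> real"
  assumes \<gamma>: "\<gamma> \<in> couplings \<mu> \<nu>" and \<nu>: "sets \<nu> = Pow (space \<nu>)" "u \<in> space \<nu>" "v \<in> space \<nu>"
    and c: "(\<lambda>p. c (fst p) (snd p)) \<in> borel_measurable (\<mu> \<Otimes>\<^sub>M \<nu>)"
    and L: "\<And>x. x \<in> space \<mu> \<Longrightarrow> \<bar>c x v - c x u\<bar> \<le> L" "0 \<le> L"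
    and t: "0 \<le> t" "t \<le> 1"
  shows "(\<integral>p. c (fst p) (snd p) \<partial>shift_coupling t u v \<mu> \<nu> \<gamma>)
    \<le> (\<integral>p. c (fst p) (snd p) \<partial>\<gamma>) + t * measure \<nu> {u} * L"
proof -
  let ?B = "measure_pmf (bernoulli_pmf t)"
  let ?h = "\<lambda>q. (fst (fst q), move u v (snd (fst q), snd q))"
  define C where "C = (\<lambda>p. c (fst p) (snd p))"
  have d: "distr \<gamma> \<nu> snd = \<nu>" and s: "sets \<gamma> = sets (\<mu> \<Otimes>\<^sub>M \<nu>)"
    using \<gamma> by (auto simp: couplings_def)
  interpret \<gamma>: prob_space \<gamma> using \<gamma> by (simp add: couplings_def)
  interpret P: pair_prob_space \<gamma> ?B ..
  note m = measurable_shift_coupling[OF \<gamma> \<nu>(1,3), of u "bernoulli_pmf t"]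
  note coupling_fst[OF \<gamma>, measurable] coupling_snd[OF \<gamma>, measurable]
  have C_prod[measurable]: "C \<in> borel_measurable (\<mu> \<Otimes>\<^sub>M \<nu>)"
    using c by (simp add: C_def)
  then have C_\<gamma>[measurable]: "C \<in> borel_measurable \<gamma>"
    by (simp cong: measurable_cong_sets add: measurable_cong_sets[OF s])
  have Ch[measurable]: "(\<lambda>q. C (?h q)) \<in> borel_measurable (\<gamma> \<Otimes>\<^sub>M ?B)"
    by (rule measurable_compose[OF m C_prod])
  have u: "{u} \<in> sets \<nu>"
    using \<nu> by auto
  define A where "A = (snd -` {u} \<inter> space \<gamma>) \<times> {True}"
  have A[measurable]: "A \<in> sets (\<gamma> \<Otimes>\<^sub>M ?B)"
    unfolding A_def using measurable_sets[OF coupling_snd[OF \<gamma>] u] by (intro pair_measureI) auto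
  have "measure (\<gamma> \<Otimes>\<^sub>M ?B) A = measure \<gamma> (snd -` {u} \<inter> space \<gamma>) * measure ?B {True}"
    unfolding A_def using measurable_sets[OF coupling_snd[OF \<gamma>] u]
    by (intro measure_pair_pmf_Times)
  also have "measure \<gamma> (snd -` {u} \<inter> space \<gamma>) = measure \<nu> {u}"
    using measure_distr[OF coupling_snd[OF \<gamma>] u] d by simp
  finally have mA: "measure (\<gamma> \<Otimes>\<^sub>M ?B) A = t * measure \<nu> {u}"
    using t by (simp add: measure_pmf_single)
  have diff: "\<bar>C (?h q) - C (fst q)\<bar> \<le> L * indicator A q" if "q \<in> space (\<gamma> \<Otimes>\<^sub>M ?B)" for q
    using that L couplings_marginals(3)[OF \<gamma>]
    by (auto simp: C_def A_def move_def space_pair_measure indicator_def)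
  have int_A: "integrable (\<gamma> \<Otimes>\<^sub>M ?B) (\<lambda>q. L * indicator A q)"
    by (intro integrable_mult_right integrable_real_indicator) (auto simp: P.emeasure_eq_measure)
  have int_diff: "integrable (\<gamma> \<Otimes>\<^sub>M ?B) (\<lambda>q. C (?h q) - C (fst q))"
    by (rule Bochner_Integration.integrable_bound[OF int_A])
      (measurable, use diff L in \<open>auto intro!: AE_I2 simp: abs_mult\<close>)
  have fst_distr: "distr (\<gamma> \<Otimes>\<^sub>M ?B) \<gamma> fst = \<gamma>"
    by (rule measure_pmf.distr_pair_fst)
  have int_fst: "integrable (\<gamma> \<Otimes>\<^sub>M ?B) (\<lambda>q. C (fst q)) \<longleftrightarrow> integrable \<gamma> C"
    using integrable_distr_eq[of fst "\<gamma> \<Otimes>\<^sub>M ?B" \<gamma> C] fst_distr by simp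
  have integral_fst: "(\<integral>q. C (fst q) \<partial>(\<gamma> \<Otimes>\<^sub>M ?B)) = integral\<^sup>L \<gamma> C"
    using integral_distr[of fst "\<gamma> \<Otimes>\<^sub>M ?B" \<gamma> C] fst_distr by simp
  have shift: "integral\<^sup>L (shift_coupling t u v \<mu> \<nu> \<gamma>) C = (\<integral>q. C (?h q) \<partial>(\<gamma> \<Otimes>\<^sub>M ?B))"
    unfolding shift_coupling_def by (rule integral_distr[OF m C_prod])
  have "integral\<^sup>L (shift_coupling t u v \<mu> \<nu> \<gamma>) C \<le> integral\<^sup>L \<gamma> C + t * measure \<nu> {u} * L"
  proof (cases "integrable \<gamma> C")
    case True
    then have int: "integrable (\<gamma> \<Otimes>\<^sub>M ?B) (\<lambda>q. C (fst q))"
      by (simp add: int_fst)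
    have "(\<integral>q. C (?h q) \<partial>(\<gamma> \<Otimes>\<^sub>M ?B)) =
        (\<integral>q. C (fst q) + (C (?h q) - C (fst q)) \<partial>(\<gamma> \<Otimes>\<^sub>M ?B))"
      by simp
    also have "\<dots> = (\<integral>q. C (fst q) \<partial>(\<gamma> \<Otimes>\<^sub>M ?B)) + (\<integral>q. C (?h q) - C (fst q) \<partial>(\<gamma> \<Otimes>\<^sub>M ?B))"
      by (rule Bochner_Integration.integral_add[OF int int_diff])
    also have "(\<integral>q. C (?h q) - C (fst q) \<partial>(\<gamma> \<Otimes>\<^sub>M ?B)) \<le> (\<integral>q. L * indicator A q \<partial>(\<gamma> \<Otimes>\<^sub>M ?B))"
      by (rule integral_mono[OF int_diff int_A]) (use diff in \<open>auto dest: abs_le_D1\<close>)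
    also have "\<dots> = t * measure \<nu> {u} * L"
      using sets.sets_into_space[OF A] by (simp add: mA Int_absorb1)
    finally show ?thesis
      using shift integral_fst by simp
  next
    case False
    have "\<not> integrable (\<gamma> \<Otimes>\<^sub>M ?B) (\<lambda>q. C (?h q))"
    proof
      assume "integrable (\<gamma> \<Otimes>\<^sub>M ?B) (\<lambda>q. C (?h q))"
      from Bochner_Integration.integrable_diff[OF this int_diff] show False
        using False int_fst by simp
    qed
    with False show ?thesis
      using shift t L by (simp add: not_integrable_integral_eq)
  qed
  then show ?thesis
    by (simp add: C_def)
qed

text \<open>The cost of a coupling is at least \<open>\<integral> c x z d\<mu> - K\<close> when \<open>c\<close> is integrable for it,
  and 0 otherwise.\<close>

lemma bdd_below_coupling_costs:
  fixes c :: "'a \<Rightarrow> 'b \<Rightarrow> real"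
  assumes z: "z \<in> space \<nu>"
    and c: "(\<lambda>p. c (fst p) (snd p)) \<in> borel_measurable (\<mu> \<Otimes>\<^sub>M \<nu>)"
    and K: "\<And>x w. x \<in> space \<mu> \<Longrightarrow> w \<in> space \<nu> \<Longrightarrow> \<bar>c x w - c x z\<bar> \<le> K"
  shows "bdd_below ((\<lambda>\<gamma>. \<integral>p. c (fst p) (snd p) \<partial>\<gamma>) ` couplings \<mu> \<nu>)"
proof (rule bdd_belowI2)
  fix \<gamma> assume \<gamma>: "\<gamma> \<in> couplings \<mu> \<nu>"
  have d: "distr \<gamma> \<mu> fst = \<mu>" and s: "sets \<gamma> = sets (\<mu> \<Otimes>\<^sub>M \<nu>)"
    using \<gamma> by (auto simp: couplings_def)
  interpret \<gamma>: prob_space \<gamma> using \<gamma> by (simp add: couplings_def)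
  note coupling_fst[OF \<gamma>, measurable]
  have C[measurable]: "(\<lambda>p. c (fst p) (snd p)) \<in> borel_measurable \<gamma>"
    using c by (simp cong: measurable_cong_sets add: measurable_cong_sets[OF s])
  have cz[measurable]: "(\<lambda>x. c x z) \<in> borel_measurable \<mu>"
    using measurable_Pair1[OF c z] by simp
  show "min 0 ((\<integral>x. c x z \<partial>\<mu>) - K) \<le> (\<integral>p. c (fst p) (snd p) \<partial>\<gamma>)"
  proof (cases "integrable \<gamma> (\<lambda>p. c (fst p) (snd p))")
    case True
    have bd: "\<bar>c (fst p) (snd p) - c (fst p) z\<bar> \<le> K" if "p \<in> space \<gamma>" for p
      using that K couplings_marginals(3)[OF \<gamma>] by auto
    have "integrable \<gamma> (\<lambda>p. c (fst p) (snd p) - c (fst p) z)"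
      by (rule \<gamma>.integrable_const_bound[of _ K]) (use bd in auto)
    from Bochner_Integration.integrable_diff[OF True this]
    have int: "integrable \<gamma> (\<lambda>p. c (fst p) z)" by simp
    have "(\<integral>x. c x z \<partial>\<mu>) - K = (\<integral>p. c (fst p) z \<partial>\<gamma>) - K"
      using integral_distr[of fst \<gamma> \<mu> "\<lambda>x. c x z"] d by simp
    also have "\<dots> = (\<integral>p. c (fst p) z - K \<partial>\<gamma>)"
      using int by (simp add: \<gamma>.prob_space)
    also have "\<dots> \<le> (\<integral>p. c (fst p) (snd p) \<partial>\<gamma>)"
      using int True by (intro integral_mono) (use bd in \<open>force simp: abs_le_iff\<close>)+
    finally show ?thesis by simp
  qed (simp add: not_integrable_integral_eq)
qed

lemma couplings_nonempty:
  assumes "prob_space \<mu>" "prob_space \<nu>"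
  shows "\<mu> \<Otimes>\<^sub>M \<nu> \<in> couplings \<mu> \<nu>"
proof -
  interpret pair_prob_space \<mu> \<nu>
    using assms by (simp add: pair_prob_space_def pair_sigma_finite_def prob_space_imp_sigma_finite)
  \<comment> \<open>The second marginal of the product is obtained from the first one by swapping.\<close>
  have "distr (\<mu> \<Otimes>\<^sub>M \<nu>) \<nu> snd = distr (distr (\<nu> \<Otimes>\<^sub>M \<mu>) (\<mu> \<Otimes>\<^sub>M \<nu>) (\<lambda>(x, y). (y, x))) \<nu> snd"
    by (subst distr_pair_swap) simp
  also have "\<dots> = distr (\<nu> \<Otimes>\<^sub>M \<mu>) \<nu> (snd \<circ> (\<lambda>(x, y). (y, x)))"
    by (rule distr_distr) simp_all
  also have "\<dots> = distr (\<nu> \<Otimes>\<^sub>M \<mu>) \<nu> fst"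
    by (simp add: comp_def case_prod_beta)
  also have "\<dots> = \<nu>"
    by (rule M1.distr_pair_fst)
  finally show ?thesis
    using M2.distr_pair_fst prob_space_axioms by (simp add: couplings_def)
qed

lemma transport_cost_shift_mass_le:
  fixes c :: "'a \<Rightarrow> 'b \<Rightarrow> real"
  assumes prob: "prob_space \<mu>" "prob_space \<nu>"
    and \<nu>: "sets \<nu> = Pow (space \<nu>)" "u \<in> space \<nu>" "v \<in> space \<nu>"
    and c: "(\<lambda>p. c (fst p) (snd p)) \<in> borel_measurable (\<mu> \<Otimes>\<^sub>M \<nu>)"
    and K: "\<And>x w. x \<in> space \<mu> \<Longrightarrow> w \<in> space \<nu> \<Longrightarrow> \<bar>c x w - c x u\<bar> \<le> K"
    and L: "\<And>x. x \<in> space \<mu> \<Longrightarrow> \<bar>c x v - c x u\<bar> \<le> L" "0 \<le> L"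
    and t: "0 \<le> t" "t \<le> 1"
  shows "transport_cost c \<mu> (shift_mass t u v \<nu>)
    \<le> transport_cost c \<mu> \<nu> + t * measure \<nu> {u} * L"
proof -
  let ?I = "\<lambda>\<gamma>. \<integral>p. c (fst p) (snd p) \<partial>\<gamma>"
  let ?\<nu>' = "shift_mass t u v \<nu>"
  have sets: "sets ?\<nu>' = sets \<nu>"
    by (simp add: shift_mass_def)
  have "bdd_below (?I ` couplings \<mu> ?\<nu>')"
    using c K sets_eq_imp_space_eq[OF sets] \<nu>
    by (intro bdd_below_coupling_costs[of u _ _ _ K])
      (simp_all cong: measurable_cong_sets
        add: measurable_cong_sets[OF sets_pair_measure_cong[OF refl sets]])
  then have "transport_cost c \<mu> ?\<nu>' - t * measure \<nu> {u} * L \<le> ?I \<gamma>"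
    if "\<gamma> \<in> couplings \<mu> \<nu>" for \<gamma>
    using cINF_lower[of ?I "couplings \<mu> ?\<nu>'" "shift_coupling t u v \<mu> \<nu> \<gamma>"]
      shift_coupling_in_couplings[OF that \<nu>(1,3), of t u]
      integral_shift_coupling_le[OF that \<nu> c L t]
    by (simp add: transport_cost_def)
  then have "transport_cost c \<mu> ?\<nu>' - t * measure \<nu> {u} * L \<le> transport_cost c \<mu> \<nu>"
    unfolding transport_cost_def[of c \<mu> \<nu>] using couplings_nonempty[OF prob]
    by (intro cINF_greatest) auto
  then show ?thesis by simp
qed

section \<open>First order conditions\<close>

text \<open>The marginal inequality behind optimality: if no small transfer from a mass \<open>q\<close> to a mass
  \<open>p\<close> pays off at the price \<open>L\<close> per unit, then \<open>f'(q) \<le> f'(p) + L\<close>. A vanishing \<open>p\<close> is excluded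
  because \<open>f'\<close> tends to \<open>-\<infinity>\<close> at 0.\<close>

lemma no_profitable_transfer:
  assumes C1: "f C1_differentiable_on {0<..}" and sc: "strictly_convex_on {0..} f"
    and deriv0: "filterlim (deriv f) at_bot (at_right 0)"
    and pq: "0 \<le> p" "0 < q"
    and transfer: "\<And>\<epsilon>. 0 < \<epsilon> \<Longrightarrow> \<epsilon> < q \<Longrightarrow> f p + f q \<le> f (p + \<epsilon>) + f (q - \<epsilon>) + \<epsilon> * L"
  shows "0 < p" and "deriv f q \<le> deriv f p + L"
proof -
  \<comment> \<open>Tangents at the two new masses are used, not at \<open>p\<close> and \<open>q\<close>: they exist even if
    \<open>p = 0\<close>.\<close>
  have *: "deriv f (q - \<epsilon>) \<le> deriv f (p + \<epsilon>) + L" if \<epsilon>: "0 < \<epsilon>" "\<epsilon> < q" for \<epsilon>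
  proof -
    have "f p > f (p + \<epsilon>) + deriv f (p + \<epsilon>) * (p - (p + \<epsilon>))"
      using \<epsilon> pq by (intro strictly_convex_above_tangent[OF C1 sc]) auto
    moreover have "f q > f (q - \<epsilon>) + deriv f (q - \<epsilon>) * (q - (q - \<epsilon>))"
      using \<epsilon> pq by (intro strictly_convex_above_tangent[OF C1 sc]) auto
    ultimately have "\<epsilon> * deriv f (q - \<epsilon>) \<le> \<epsilon> * (deriv f (p + \<epsilon>) + L)"
      using transfer[OF \<epsilon>] by (simp add: algebra_simps)
    then show ?thesis
      using \<epsilon>(1) by simp
  qed
  have small: "\<forall>\<^sub>F \<epsilon> in at_right 0. 0 < \<epsilon> \<and> \<epsilon> < q / 2"
    using pq by (auto simp: eventually_at_right_field intro!: exI[of _ "q / 2"])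
  show p: "0 < p"
  proof (rule ccontr)
    assume "\<not> 0 < p"
    with pq have "p = 0" by simp
    have "\<forall>\<^sub>F \<epsilon> in at_right 0. deriv f \<epsilon> < deriv f (q / 2) - L"
      using deriv0 by (simp add: filterlim_at_bot_dense)
    with small have "\<forall>\<^sub>F \<epsilon>::real in at_right 0. False"
    proof eventually_elim
      fix \<epsilon> :: real
      assume \<epsilon>: "0 < \<epsilon> \<and> \<epsilon> < q / 2" "deriv f \<epsilon> < deriv f (q / 2) - L"
      have "deriv f (q / 2) \<le> deriv f (q - \<epsilon>)"
        using \<epsilon>(1) pq by (subst deriv_mono_iff[OF C1 sc]) auto
      with *[of \<epsilon>] \<epsilon> \<open>p = 0\<close> show False by simp
    qed
    then show False by simp
  qed
  have cont: "isCont (deriv f) s" if "s > 0" for s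
    using C1_continuous_deriv[OF C1] that by (simp add: continuous_on_eq_continuous_at)
  have q_lim: "((\<lambda>\<epsilon>. deriv f (q - \<epsilon>)) \<longlongrightarrow> deriv f q) (at_right 0)"
    by (rule isCont_tendsto_compose[OF cont[OF pq(2)]]) (auto intro!: tendsto_eq_intros)
  have p_lim: "((\<lambda>\<epsilon>. deriv f (p + \<epsilon>) + L) \<longlongrightarrow> deriv f p + L) (at_right 0)"
    by (intro tendsto_add tendsto_const isCont_tendsto_compose[OF cont[OF p]])
      (auto intro!: tendsto_eq_intros)
  show "deriv f q \<le> deriv f p + L"
    by (rule tendsto_le[OF _ p_lim q_lim])
      (use small in \<open>auto elim!: eventually_mono intro!: *\<close>)
qed

text \<open>Comparison of all masses with the first one turns the marginal inequalities into a lower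
  bound: with \<open>s = f'(w 1)\<close> one has \<open>w j \<le> (f')\<^sup>-\<^sup>1 (s + a j)\<close>, so summing to 1 forces
  \<open>s \<ge> J f N (- a) 1\<close>, and \<open>w i \<ge> (f')\<^sup>-\<^sup>1 (s - a i)\<close>.\<close>

lemma mass_lower_bound:
  assumes C1: "f C1_differentiable_on {0<..}" and sc: "strictly_convex_on {0..} f"
    and superlin: "filterlim (\<lambda>s. f s / s) at_top at_top"
    and deriv0: "filterlim (deriv f) at_bot (at_right 0)"
    and pos: "\<And>i. i \<in> {1..N} \<Longrightarrow> 0 < w i" and sum: "(\<Sum>i=1..N. w i) = 1"
    and lower: "\<And>i. i \<in> {1..N} \<Longrightarrow> deriv f (w 1) \<le> deriv f (w i) + a i"
    and upper: "\<And>i. i \<in> {1..N} \<Longrightarrow> deriv f (w i) \<le> deriv f (w 1) + a i"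
    and i: "i \<in> {1..N}"
  shows "deriv_inv f (J f N (\<lambda>j. - a j) 1 - a i) \<le> w i"
proof -
  note dinv = C1 sc superlin deriv0
  define s where "s = deriv f (w 1)"
  define J1 where "J1 = J f N (\<lambda>j. - a j) 1"
  have inv: "deriv_inv f (deriv f (w j)) = w j" if "j \<in> {1..N}" for j
    by (rule deriv_inv_deriv[OF dinv pos[OF that]])
  have "J1 \<le> s"
  proof (rule ccontr)
    assume "\<not> J1 \<le> s"
    have "(\<Sum>j=1..N. w j) < (\<Sum>j=1..N. deriv_inv f (J1 - (- a j)))"
    proof (rule sum_strict_mono)
      fix j assume j: "j \<in> {1..N}"
      have "\<not> J1 + a j \<le> deriv f (w j)"
        using upper[OF j] \<open>\<not> J1 \<le> s\<close> by (simp add: s_def)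
      then show "w j < deriv_inv f (J1 - (- a j))"
        using deriv_inv_le_iff[OF dinv, of "J1 + a j" "deriv f (w j)"] inv[OF j] by simp
    qed (use i in auto)
    then show False
      using sum sum_deriv_inv_J[OF dinv, of N "\<lambda>j. - a j"] i by (simp add: J1_def)
  qed
  then have "J1 - a i \<le> deriv f (w i)"
    using lower[OF i] by (simp add: s_def)
  then show ?thesis
    using deriv_inv_le_iff[OF dinv, of "J1 - a i" "deriv f (w i)"] inv[OF i] by (simp add: J1_def)
qed

lemma sets_prob_measures_on_finite:
  fixes S :: "'a::t1_space set"
  assumes "\<nu> \<in> prob_measures_on S" "finite S"
  shows "sets \<nu> = Pow S" and "space \<nu> = S"
proof -
  have "A \<in> (\<inter>) S ` sets borel" if "A \<subseteq> S" for A
  proof -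
    have "A = S \<inter> A" "A \<in> sets borel"
      using that finite_subset[OF that assms(2)] by (auto intro: borel_closed finite_imp_closed)
    then show ?thesis by (rule image_eqI)
  qed
  then show "sets \<nu> = Pow S"
    using assms(1) by (auto simp: prob_measures_on_def sets_restrict_space)
  then show "space \<nu> = S"
    using sets.top[of \<nu>] sets.sets_into_space[of S \<nu>] by auto
qed

lemma energy_shift_mass:
  assumes \<nu>: "prob_space \<nu>" "sets \<nu> = Pow (space \<nu>)" "space \<nu> = y ` {1..N}"
    and inj: "inj_on y {1..N}" and ij: "i \<in> {1..N}" "j \<in> {1..N}" "i \<noteq> j"
    and t: "0 \<le> t" "t \<le> 1"
  shows "energy f y N (shift_mass t (y j) (y i) \<nu>) + f (measure \<nu> {y i}) + f (measure \<nu> {y j}) =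
    energy f y N \<nu> + f (measure \<nu> {y i} + t * measure \<nu> {y j})
      + f (measure \<nu> {y j} - t * measure \<nu> {y j})"
proof -
  let ?R = "{1..N} - {i} - {j}"
  have split: "(\<Sum>k=1..N. g k) = g i + g j + (\<Sum>k\<in>?R. g k)" for g :: "nat \<Rightarrow> real"
    using ij sum.remove[of "{1..N}" i g] sum.remove[of "{1..N} - {i}" j g] by simp
  have "y i \<noteq> y j"
    using inj ij by (auto dest: inj_onD)
  then have m: "measure (shift_mass t (y j) (y i) \<nu>) {y k} =
      (if k = j then (1 - t) * measure \<nu> {y j} else
       if k = i then measure \<nu> {y i} + t * measure \<nu> {y j} else measure \<nu> {y k})"
    if "k \<in> {1..N}" for k
    using that \<nu>(3) ij t inj_on_eq_iff[OF inj that]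
    by (subst measure_shift_mass[OF \<nu>(1,2)]) auto
  have "(\<Sum>k\<in>?R. f (measure (shift_mass t (y j) (y i) \<nu>) {y k})) = (\<Sum>k\<in>?R. f (measure \<nu> {y k}))"
    by (rule sum.cong) (auto simp: m)
  then show ?thesis
    using ij unfolding energy_def split by (simp add: m algebra_simps)
qed

text \<open>A minimiser admits no profitable transfer of mass: moving \<open>\<epsilon>\<close> units from \<open>y j\<close> to \<open>y i\<close>
  changes the transport cost by at most \<open>\<epsilon> M \<bar>y i - y j\<bar>\<close>.\<close>

lemma minimizer_transfer:
  fixes y :: "nat \<Rightarrow> real" and c :: "'a \<Rightarrow> real \<Rightarrow> real"
  assumes \<mu>: "prob_space \<mu>" and inj: "inj_on y {1..N}"
    and c: "\<And>i. i \<in> {1..N} \<Longrightarrow> (\<lambda>x. c x (y i)) \<in> borel_measurable \<mu>"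
    and lip: "\<And>x i j. x \<in> space \<mu> \<Longrightarrow> i \<in> {1..N} \<Longrightarrow> j \<in> {1..N} \<Longrightarrow>
      \<bar>c x (y i) - c x (y j)\<bar> \<le> M * \<bar>y i - y j\<bar>"
    and min: "is_arg_min (\<lambda>\<nu>. transport_cost c \<mu> \<nu> + energy f y N \<nu>)
      (\<lambda>\<nu>. \<nu> \<in> prob_measures_on (y ` {1..N})) \<nu>"
    and ij: "i \<in> {1..N}" "j \<in> {1..N}" "i \<noteq> j"
    and \<epsilon>: "0 < \<epsilon>" "\<epsilon> < measure \<nu> {y j}"
  shows "f (measure \<nu> {y i}) + f (measure \<nu> {y j}) \<le>
    f (measure \<nu> {y i} + \<epsilon>) + f (measure \<nu> {y j} - \<epsilon>) + \<epsilon> * (M * \<bar>y i - y j\<bar>)"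
proof -
  let ?Y = "y ` {1..N}"
  have mem: "\<nu> \<in> prob_measures_on ?Y"
    using min by (simp add: is_arg_min_def)
  note \<nu> = sets_prob_measures_on_finite[OF mem finite_imageI[OF finite_atLeastAtMost]]
  have prob: "prob_space \<nu>"
    using mem by (simp add: prob_measures_on_def)
  have Pow: "sets \<nu> = Pow (space \<nu>)"
    using \<nu> by simp
  define t where "t = \<epsilon> / measure \<nu> {y j}"
  have t: "0 \<le> t" "t \<le> 1" "t * measure \<nu> {y j} = \<epsilon>"
    using \<epsilon> by (auto simp: t_def)
  let ?\<nu>' = "shift_mass t (y j) (y i) \<nu>"
  have mem': "?\<nu>' \<in> prob_measures_on ?Y"
    using mem ij \<nu> prob_space_shift_mass[OF prob Pow] sets_shift_mass[OF prob Pow]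
    by (simp add: prob_measures_on_def)
  have meas: "(\<lambda>p. c (fst p) (snd p)) \<in> borel_measurable (\<mu> \<Otimes>\<^sub>M \<nu>)"
  proof (rule measurable_compose_countable'[where I = ?Y and g = snd])
    show "(\<lambda>p. c (fst p) w) \<in> borel_measurable (\<mu> \<Otimes>\<^sub>M \<nu>)" if "w \<in> ?Y" for w
      using that by (auto intro: measurable_compose[OF measurable_fst c])
    show "snd \<in> measurable (\<mu> \<Otimes>\<^sub>M \<nu>) (count_space ?Y)"
      using \<nu>(1) measurable_snd[of \<mu> \<nu>] by (subst measurable_cong_sets[OF refl, of _ \<nu>]) auto
  qed auto
  have lip0: "0 \<le> M * \<bar>y k - y j\<bar>" if "k \<in> {1..N}" for k
    using lip[OF _ that ij(2)] prob_space.not_empty[OF \<mu>] by force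
  \<comment> \<open>Any bound uniform in \<open>x\<close> and \<open>w\<close> will do; the sum over all target points is one.\<close>
  have bound: "\<bar>c x w - c x (y j)\<bar> \<le> (\<Sum>k=1..N. M * \<bar>y k - y j\<bar>)"
    if xw: "x \<in> space \<mu>" "w \<in> space \<nu>" for x w
  proof -
    obtain k where k: "k \<in> {1..N}" "w = y k"
      using xw(2) \<nu>(2) by blast
    then have "\<bar>c x w - c x (y j)\<bar> \<le> M * \<bar>y k - y j\<bar>"
      using lip[OF xw(1) k(1) ij(2)] by simp
    also have "\<dots> \<le> (\<Sum>k=1..N. M * \<bar>y k - y j\<bar>)"
      by (rule member_le_sum[OF k(1)]) (use lip0 in auto)
    finally show ?thesis .
  qed
  have in_space: "y j \<in> space \<nu>" "y i \<in> space \<nu>"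
    using ij \<nu>(2) by auto
  have "transport_cost c \<mu> ?\<nu>'
      \<le> transport_cost c \<mu> \<nu> + t * measure \<nu> {y j} * (M * \<bar>y i - y j\<bar>)"
    by (rule transport_cost_shift_mass_le[OF \<mu> prob Pow in_space meas bound lip[OF _ ij(1,2)]
          lip0[OF ij(1)] t(1,2)])
  moreover have "\<not> transport_cost c \<mu> ?\<nu>' + energy f y N ?\<nu>'
      < transport_cost c \<mu> \<nu> + energy f y N \<nu>"
    using min mem' unfolding is_arg_min_def by blast
  ultimately show ?thesis
    using energy_shift_mass[OF prob Pow \<nu>(2) inj ij t(1,2), of f] by (simp add: t(3))
qed

section \<open>Superlevel sets and nestedness\<close>

text \<open>Splitting levels exist: without level sets of positive mass, the distribution function of
  the cost difference is continuous, so the intermediate value theorem applies to it.\<close>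

lemma superlevel_mass_attained:
  fixes d :: "'a \<Rightarrow> real"
  assumes "prob_space M" and d[measurable]: "d \<in> borel_measurable M"
    and bd: "\<And>x. x \<in> space M \<Longrightarrow> \<bar>d x\<bar> \<le> K"
    and null: "\<And>k. measure M {x \<in> space M. d x = k} = 0"
    and S: "0 \<le> S" "S \<le> 1"
  shows "\<exists>k. measure M {x \<in> space M. k \<le> d x} = (S::real)"
proof -
  interpret prob_space M by fact
  interpret D: real_distribution "distr M borel d"
    by (rule real_distribution_distr[OF d])
  let ?F = "cdf (distr M borel d)"
  have F: "?F k = prob {x \<in> space M. d x \<le> k}" for k
    unfolding cdf_def by (subst measure_distr) (auto intro!: arg_cong[where f=prob])
  have atom: "measure (distr M borel d) {k} = 0" for k
    using null[of k] by (subst measure_distr) (auto simp: vimage_def Int_def conj_commute)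
  have ge: "prob {x \<in> space M. k \<le> d x} = 1 - ?F k" for k
  proof -
    have "?F k = prob ({x \<in> space M. d x < k} \<union> {x \<in> space M. d x = k})"
      unfolding F by (rule arg_cong[where f=prob]) auto
    also have "\<dots> = prob {x \<in> space M. d x < k}"
      using null[of k] by (subst finite_measure_Union) auto
    also have "\<dots> = 1 - prob {x \<in> space M. k \<le> d x}"
      by (subst prob_compl[symmetric]) (auto intro!: arg_cong[where f=prob])
    finally show ?thesis by simp
  qed
  have "{x \<in> space M. d x \<le> - \<bar>K\<bar> - 1} = {}" "{x \<in> space M. d x \<le> \<bar>K\<bar>} = space M"
    using bd by force+
  then have "?F (- \<bar>K\<bar> - 1) = 0" "?F \<bar>K\<bar> = 1"
    unfolding F by (simp_all only: prob_space measure_empty)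
  moreover have "- \<bar>K\<bar> - 1 \<le> \<bar>K\<bar>"
    by simp
  ultimately obtain k where "?F k = 1 - S"
    using IVT[of ?F "- \<bar>K\<bar> - 1" "1 - S" "\<bar>K\<bar>"] S atom by (auto simp: D.isCont_cdf)
  then show ?thesis
    using ge by (intro exI[of _ k]) simp
qed

text \<open>If the superlevel set of index \<open>i+1\<close> at level \<open>k'\<close> outweighs that of index \<open>i\<close> at level \<open>k\<close> by
  more than the minimal mass difference, then \<open>k'\<close> lies strictly below \<open>k_max\<close>. The supremum
  \<open>k_max\<close> is itself an admissible level: the superlevel set there is the intersection of those of all smaller levels, so it still
  contains the superlevel set of index \<open>i\<close>.\<close>

lemma X_ge_subset_X_gt:
  assumes "finite_measure \<mu>"
    and meas: "\<And>l. X_ge X c y i l \<in> sets \<mu>" "\<And>l. X_ge X c y (i + 1) l \<in> sets \<mu>"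
    and less: "measure \<mu> (X_ge X c y i (ereal k)) + D_min X c y \<mu> i k
      < measure \<mu> (X_ge X c y (i + 1) (ereal k'))"
  shows "X_ge X c y i (ereal k) \<subseteq> X_gt X c y (i + 1) k'"
proof -
  interpret finite_measure \<mu> by fact
  let ?A = "X_ge X c y i (ereal k)" and ?B = "X_ge X c y (i + 1) (k_max X c y i k)"
  have AX: "x \<in> X" if "x \<in> ?A" for x
    using that by (simp add: X_ge_def)
  have kmax: "k_max X c y i k \<le> ereal (c x (y (i + 1 + 1)) - c x (y (i + 1)))" if "x \<in> ?A" for x
    unfolding k_max_def using that by (intro Sup_least) (auto simp: X_ge_def)
  then have "?A \<subseteq> ?B"
    using AX unfolding X_ge_def[of X c y "i + 1"] by blast
  then have B: "measure \<mu> ?B = measure \<mu> ?A + D_min X c y \<mu> i k"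
    using finite_measure_Diff[OF meas(2) meas(1)] by (simp add: D_min_def)
  have lt: "ereal k' < k_max X c y i k"
  proof (rule ccontr)
    assume "\<not> ereal k' < k_max X c y i k"
    then have "k_max X c y i k \<le> ereal k'"
      by (simp only: not_less)
    then have "X_ge X c y (i + 1) (ereal k') \<subseteq> ?B"
      unfolding X_ge_def by (blast intro: order_trans)
    from finite_measure_mono[OF this meas(2)] show False
      using less B by linarith
  qed
  show ?thesis
  proof
    fix x assume x: "x \<in> ?A"
    have "k' < c x (y (i + 1 + 1)) - c x (y (i + 1))"
      using less_le_trans[OF lt kmax[OF x]] by simp
    then show "x \<in> X_gt X c y (i + 1) k'"
      using AX[OF x] by (simp add: X_gt_def X_ge_def X_eq_def)
  qed
qed

lemma C2_on_imp_continuous_on: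
  assumes "C2_on X g"
  shows "continuous_on X g"
  using assms unfolding C2_on_def
  by (meson continuous_at_imp_continuous_on has_derivative_continuous)

section \<open>Nestedness of the minimiser\<close>

theorem theorem3p2:
  fixes X :: "(real ^ 'd) set"
    and y :: "nat \<Rightarrow> real" and N :: nat
    and c :: "real ^ 'd \<Rightarrow> real \<Rightarrow> real"
    and \<mu> :: "(real ^ 'd) measure" and \<nu> :: "real measure"
    and f :: "real \<Rightarrow> real" and M :: real and a :: "nat \<Rightarrow> real"
  assumes "open X" and "bounded X"
    and "inj_on y {1..N}"
    and "\<forall>i\<in>{1..N}. C2_on X (\<lambda>x. c x (y i))"
    and "\<forall>i\<in>{1..N-1}. \<forall>x\<in>X.
           frechet_derivative (\<lambda>x. c x (y (i + 1))) (at x)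
             \<noteq> frechet_derivative (\<lambda>x. c x (y i)) (at x)"
    and "\<mu> \<in> prob_measures_on X"
    and "\<forall>i\<in>{1..N-1}. \<forall>k. measure \<mu> (X_eq X c y i k) = 0"
    and "f C1_differentiable_on {0<..}"
    and "strictly_convex_on {0..} f"
    and "filterlim (\<lambda>s. f s / s) at_top at_top"
    and "filterlim (deriv f) at_bot (at_right 0)"
    and "bdd_above (cost_slopes X c y N)"
    and "M = Sup (cost_slopes X c y N)"
    and "\<forall>j\<in>{1..N}. a j = M * \<bar>y j - y 1\<bar>"
    and "\<forall>i\<in>{1..N-2}.
           (SUP k. D_min X c y \<mu> i k)
             - deriv_inv f (J f N (\<lambda>j. - a j) 1 - M * \<bar>y (i + 1) - y 1\<bar>) < 0"
    and "is_arg_min (\<lambda>\<nu>. transport_cost c \<mu> \<nu> + energy f y N \<nu>)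
           (\<lambda>\<nu>. \<nu> \<in> prob_measures_on (y ` {1..N})) \<nu>"
  shows "discretely_nested X c y N \<mu> \<nu>"
proof -
  note f = \<open>f C1_differentiable_on {0<..}\<close> \<open>strictly_convex_on {0..} f\<close>
    \<open>filterlim (\<lambda>s. f s / s) at_top at_top\<close> \<open>filterlim (deriv f) at_bot (at_right 0)\<close>
  note inj = \<open>inj_on y {1..N}\<close> and min = assms(16)
  have sets_\<mu>: "sets \<mu> = sets (restrict_space borel X)" and \<mu>: "prob_space \<mu>"
    using \<open>\<mu> \<in> prob_measures_on X\<close> by (auto simp: prob_measures_on_def)
  interpret \<mu>: prob_space \<mu> by (rule \<mu>)
  have space_\<mu>: "space \<mu> = X"
    using sets_eq_imp_space_eq[OF sets_\<mu>] by (simp add: space_restrict_space)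
  have mem: "\<nu> \<in> prob_measures_on (y ` {1..N})"
    using min by (simp add: is_arg_min_def)
  note \<nu> = sets_prob_measures_on_finite[OF mem finite_imageI[OF finite_atLeastAtMost]]
  interpret \<nu>: prob_space \<nu>
    using mem by (simp add: prob_measures_on_def)
  define w where "w i = measure \<nu> {y i}" for i
  have c_meas: "(\<lambda>x. c x (y i)) \<in> borel_measurable \<mu>" if "i \<in> {1..N}" for i
  proof -
    have "(\<lambda>x. c x (y i)) \<in> borel_measurable (restrict_space borel X)"
      using assms(4) that
      by (intro borel_measurable_continuous_on_restrict C2_on_imp_continuous_on) auto
    then show ?thesis
      by (simp add: measurable_cong_sets[OF sets_\<mu> refl])
  qed
  have lip: "\<bar>c x (y i) - c x (y j)\<bar> \<le> M * \<bar>y i - y j\<bar>"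
    if "x \<in> space \<mu>" "i \<in> {1..N}" "j \<in> {1..N}" for x i j
  proof (cases "i = j")
    case False
    then have "\<bar>c x (y i) - c x (y j)\<bar> / \<bar>y i - y j\<bar> \<le> M"
      unfolding \<open>M = _\<close> using that space_\<mu> \<open>bdd_above _\<close>
      by (intro cSup_upper) (auto simp: cost_slopes_def)
    moreover have "\<bar>y i - y j\<bar> > 0"
      using False that inj by (auto dest: inj_onD)
    ultimately show ?thesis
      by (simp add: field_simps)
  qed simp
  have sum_w: "(\<Sum>i=1..r. w i) = measure \<nu> (y ` {1..r})" if "r \<le> N" for r
  proof -
    have inj': "inj_on y {1..r}"
      using inj by (rule inj_on_subset) (use that in auto)
    have "measure \<nu> (y ` {1..r}) = (\<Sum>z\<in>y ` {1..r}. measure \<nu> {z})"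
      using that \<nu> by (intro \<nu>.finite_measure_eq_sum_singleton) auto
    also have "\<dots> = (\<Sum>i=1..r. w i)"
      by (subst sum.reindex[OF inj']) (simp add: w_def)
    finally show ?thesis by simp
  qed
  have sum_one: "(\<Sum>i=1..N. w i) = 1"
    using sum_w[of N] \<nu> \<nu>.prob_space by simp

  have transfer: "f (w i) + f (w j) \<le> f (w i + \<epsilon>) + f (w j - \<epsilon>) + \<epsilon> * (M * \<bar>y i - y j\<bar>)"
    if "i \<in> {1..N}" "j \<in> {1..N}" "i \<noteq> j" "0 < \<epsilon>" "\<epsilon> < w j" for i j \<epsilon>
    unfolding w_def using minimizer_transfer[OF \<mu> inj c_meas lip min] that by (simp add: w_def)
  have pos: "0 < w i" if i: "i \<in> {1..N}" for i
  proof (rule ccontr)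
    assume "\<not> 0 < w i"
    moreover obtain j where j: "j \<in> {1..N}" "0 < w j"
    proof -
      have "\<exists>j\<in>{1..N}. 0 < w j"
        using sum_one sum_nonpos[of "{1..N}" w] by force
      then show thesis using that by blast
    qed
    ultimately have "i \<noteq> j" by auto
    then have "0 < w i"
      using no_profitable_transfer(1)[OF f(1,2,4) _ j(2) transfer[OF i j(1)]]
      by (simp add: w_def)
    with \<open>\<not> 0 < w i\<close> show False ..
  qed
  have marginal: "deriv f (w j) \<le> deriv f (w i) + M * \<bar>y i - y j\<bar>"
    if "i \<in> {1..N}" "j \<in> {1..N}" for i j
  proof (cases "i = j")
    case False
    then show ?thesis
      using no_profitable_transfer(2)[OF f(1,2,4) _ pos[OF that(2)] transfer[OF that]] pos[OF that(1)]
      by simp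
  qed simp
  have large: "D_min X c y \<mu> i k < w (i + 1)" if i: "i \<in> {1..N-2}" for i k
  proof -
    have "D_min X c y \<mu> i k \<le> (SUP k. D_min X c y \<mu> i k)"
      by (rule cSUP_upper) (auto simp: D_min_def intro!: bdd_aboveI[of _ 1])
    also have "\<dots> < deriv_inv f (J f N (\<lambda>j. - a j) 1 - a (i + 1))"
      using assms(14,15) i by auto
    also have "\<dots> \<le> w (i + 1)"
    proof (rule mass_lower_bound[OF f pos sum_one])
      fix j assume j: "j \<in> {1..N}"
      have 1: "1 \<in> {1..N}" using i by auto
      have "a j = M * \<bar>y j - y 1\<bar>"
        using assms(14) j by blast
      then show "deriv f (w 1) \<le> deriv f (w j) + a j" "deriv f (w j) \<le> deriv f (w 1) + a j"
        using marginal[OF j 1] marginal[OF 1 j] by (simp_all add: abs_minus_commute)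
    qed (use i in auto)
    finally show ?thesis .
  qed

  have diff_meas: "(\<lambda>x. c x (y (i + 1)) - c x (y i)) \<in> borel_measurable \<mu>" if "i \<in> {1..N-1}" for i
    using that by (intro borel_measurable_diff c_meas) auto
  have X_ge_sets: "X_ge X c y i l \<in> sets \<mu>" if "i \<in> {1..N-1}" for i l
    unfolding X_ge_def space_\<mu>[symmetric] using diff_meas[OF that] by measurable
  have "\<exists>k. \<forall>r\<in>{1..N-1}. measure \<mu> (X_ge X c y r (ereal (k r))) = (\<Sum>i=1..r. w i)"
  proof (rule bchoice[THEN exE], rule ballI)
    fix r assume r: "r \<in> {1..N-1}"
    have "(\<Sum>i=1..r. w i) = measure \<nu> (y ` {1..r})"
      using r by (intro sum_w) auto
    then have "\<exists>k. measure \<mu> {x \<in> space \<mu>. k \<le> c x (y (r + 1)) - c x (y r)} = (\<Sum>i=1..r. w i)"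
      using r assms(7) space_\<mu>
      by (intro superlevel_mass_attained[OF \<mu> diff_meas[OF r] lip]) (auto simp: X_eq_def)
    then show "\<exists>k. measure \<mu> (X_ge X c y r (ereal k)) = (\<Sum>i=1..r. w i)"
      by (simp add: X_ge_def space_\<mu>)
  qed blast
  then have "\<exists>k. splitting_levels X c y N \<mu> \<nu> k"
    by (simp add: splitting_levels_def w_def)
  moreover have "X_ge X c y i (ereal (k i)) \<subseteq> X_gt X c y (i + 1) (k (i + 1))"
    if k: "splitting_levels X c y N \<mu> \<nu> k" and i: "i \<in> {1..N-2}" for k i
  proof (rule X_ge_subset_X_gt)
    have r: "i \<in> {1..N-1}" "i + 1 \<in> {1..N-1}"
      using i by auto
    show "X_ge X c y i l \<in> sets \<mu>" "X_ge X c y (i + 1) l \<in> sets \<mu>" for l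
      using r X_ge_sets by blast+
    have "measure \<mu> (X_ge X c y i (ereal (k i))) = (\<Sum>j=1..i. w j)"
      "measure \<mu> (X_ge X c y (i + 1) (ereal (k (i + 1)))) = (\<Sum>j=1..i. w j) + w (i + 1)"
      using k r unfolding splitting_levels_def w_def by auto
    then show "measure \<mu> (X_ge X c y i (ereal (k i))) + D_min X c y \<mu> i (k i)
        < measure \<mu> (X_ge X c y (i + 1) (ereal (k (i + 1))))"
      using large[OF i] by simp
  qed (rule \<mu>.finite_measure_axioms)
  ultimately show ?thesis
    by (auto simp: discretely_nested_def)
qed

end
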